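(* Let $\Delta$ be of type $B_n$ and let $\mathfrak{Ab}$ be its poset of abelian ideals. Then (i) $\mathcal K^{u}_{\mathfrak{Ab}}(q)=\sum_{k\ge0}\binom{n+1}{2k}q^k$; (ii) $\mathcal K^{l}_{\mathfrak{Ab}}(q)=\sum_{k\ge0}\big(\binom{n-1}{2k+1}+\binom{n}{2k-1}+\binom{n-1}{2k-2}\big)q^k$; (iii) $D_{\mathfrak{Ab}}(q)=-\sum_{k\ge0}\binom{n-2}{2k+1}q^k$.
   Context: Type $B_n$: positive roots $\Delta^+=\{\varepsilon_i\pm\varepsilon_j\ (1\le i<j\le n),\ \varepsilon_i\ (1\le i\le n)\}$, simple roots $\varepsilon_i-\varepsilon_{i+1}$ ($i<n$), $\varepsilon_n$, with the root order (generated by $\gamma$ covering $\mu$ iff $\gamma-\mu$ is a simple root). An upper ideal $I\subset\Delta^+$ (up-closed subset) is abelian if $\gamma'+\gamma''\notin\Delta^+$ for all $\gamma',\gamma''\in I$; $\mathfrak{Ab}$ is the poset of all abelian upper ideals (including $\varnothing$) ordered by inclusion. For a finite poset $\mathcal P$, $\kappa(x)$ (resp. $\iota(x)$) is the number of elements covered by (resp. covering) $x$; $\mathcal K^{u}_{\mathcal P}=\sum_x q^{\kappa(x)}$, $\mathcal K^{l}_{\mathcal P}=\sum_x q^{\iota(x)}$, and $D_{\mathcal P}$ is defined by $\mathcal K^{u}_{\mathcal P}-\mathcal K^{l}_{\mathcal P}=(q-1)^2D_{\mathcal P}$. Binomial coefficients with negative lower index are $0$. *)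

theory Defs
  imports "HOL-Library.Function_Algebras" "HOL-Computational_Algebra.Polynomial"
begin

text \<open>
  Roots are integer coordinate vectors, encoded as functions on the index set with all
  coordinates outside \<open>{1..n}\<close> equal to zero; \<open>+\<close> and \<open>-\<close> on them are
  pointwise.
\<close>

definition eps :: "nat \<Rightarrow> nat \<Rightarrow> int" where
  "eps i = (\<lambda>j. if j = i then 1 else 0)"

definition pos_roots_B :: "nat \<Rightarrow> (nat \<Rightarrow> int) set" where
  "pos_roots_B n =
     {eps i - eps j |i j. 1 \<le> i \<and> i < j \<and> j \<le> n} \<union>
     {eps i + eps j |i j. 1 \<le> i \<and> i < j \<and> j \<le> n} \<union>
     {eps i |i. 1 \<le> i \<and> i \<le> n}"

definition simple_roots_B :: "nat \<Rightarrow> (nat \<Rightarrow> int) set" where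
  "simple_roots_B n = {eps i - eps (i + 1) |i. 1 \<le> i \<and> i < n} \<union> {eps n}"

definition root_step_B :: "nat \<Rightarrow> (nat \<Rightarrow> int) \<Rightarrow> (nat \<Rightarrow> int) \<Rightarrow> bool" where
  "root_step_B n \<mu> \<gamma> \<longleftrightarrow>
     \<mu> \<in> pos_roots_B n \<and> \<gamma> \<in> pos_roots_B n \<and> \<gamma> - \<mu> \<in> simple_roots_B n"

definition root_le_B :: "nat \<Rightarrow> (nat \<Rightarrow> int) \<Rightarrow> (nat \<Rightarrow> int) \<Rightarrow> bool" where
  "root_le_B n = (root_step_B n)\<^sup>*\<^sup>*"

definition upper_ideal_B :: "nat \<Rightarrow> (nat \<Rightarrow> int) set \<Rightarrow> bool" where
  "upper_ideal_B n I \<longleftrightarrow>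
     I \<subseteq> pos_roots_B n \<and>
     (\<forall>\<mu>\<in>I. \<forall>\<gamma>\<in>pos_roots_B n. root_le_B n \<mu> \<gamma> \<longrightarrow> \<gamma> \<in> I)"

definition abelian_B :: "nat \<Rightarrow> (nat \<Rightarrow> int) set \<Rightarrow> bool" where
  "abelian_B n I \<longleftrightarrow> (\<forall>\<gamma>'\<in>I. \<forall>\<gamma>''\<in>I. \<gamma>' + \<gamma>'' \<notin> pos_roots_B n)"

definition Ab_B :: "nat \<Rightarrow> (nat \<Rightarrow> int) set set" where
  "Ab_B n = {I. upper_ideal_B n I \<and> abelian_B n I}"

text \<open>
  A finite poset is a finite set \<open>P\<close> in a type of class \<open>order\<close>, with the order induced
  from the type. For a set of sets, such as \<open>Ab_B n\<close>, this order is inclusion.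
\<close>

definition covers_in :: "'a::order set \<Rightarrow> 'a \<Rightarrow> 'a \<Rightarrow> bool" where
  "covers_in P y x \<longleftrightarrow> x \<in> P \<and> y \<in> P \<and> x < y \<and> \<not> (\<exists>z\<in>P. x < z \<and> z < y)"

definition kappa :: "'a::order set \<Rightarrow> 'a \<Rightarrow> nat" where
  "kappa P x = card {y \<in> P. covers_in P x y}"

definition iota :: "'a::order set \<Rightarrow> 'a \<Rightarrow> nat" where
  "iota P x = card {y \<in> P. covers_in P y x}"

definition upper_cov_poly :: "'a::order set \<Rightarrow> int poly" where
  "upper_cov_poly P = (\<Sum>x\<in>P. monom 1 (kappa P x))"

definition lower_cov_poly :: "'a::order set \<Rightarrow> int poly" where
  "lower_cov_poly P = (\<Sum>x\<in>P. monom 1 (iota P x))"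

definition deviation_poly :: "'a::order set \<Rightarrow> int poly" where
  "deviation_poly P =
     (THE D. upper_cov_poly P - lower_cov_poly P = [:-1, 1:]\<^sup>2 * D)"

text \<open>
  The deviation polynomial of a finite poset is well defined: at \<open>q = 1\<close> both covering
  polynomials count the elements, and both derivatives count the covering pairs.
\<close>

lemma double_root_one_dvd:
  fixes p :: "int poly"
  assumes "poly p 1 = 0" "poly (pderiv p) 1 = 0"
  shows "[:-1, 1:]\<^sup>2 dvd p"
proof -
  obtain r where r: "p = [:-1, 1:] * r"
    using assms(1) by (auto simp: poly_eq_0_iff_dvd elim: dvdE)
  have "poly r 1 = 0"
    using assms(2) unfolding r pderiv_mult by (simp add: pderiv_pCons)
  then obtain s where "r = [:-1, 1:] * s"
    by (auto simp: poly_eq_0_iff_dvd elim: dvdE)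
  then have "p = [:-1, 1:]\<^sup>2 * s"
    using r by (simp only: power2_eq_square mult.assoc)
  then show ?thesis by (rule dvdI)
qed

lemma sum_kappa_eq_sum_iota:
  assumes "finite P"
  shows "(\<Sum>x\<in>P. kappa P x) = (\<Sum>x\<in>P. iota P x)"
proof -
  have count: "card {y\<in>P. Q y} = (\<Sum>y\<in>P. if Q y then 1 else 0)" for Q
    using assms by (simp add: sum.If_cases Int_def conj_commute)
  show ?thesis
    unfolding kappa_def iota_def count by (rule sum.swap)
qed

lemma deviation_poly_eqI:
  assumes "upper_cov_poly P - lower_cov_poly P = [:-1, 1:]\<^sup>2 * D"
  shows "deviation_poly P = D"
  unfolding deviation_poly_def using assms by (intro the_equality) auto

lemma deviation_poly_eq:
  assumes "finite P"
  shows "upper_cov_poly P - lower_cov_poly P = [:-1, 1:]\<^sup>2 * deviation_poly P"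
proof -
  have pderiv_sum: "pderiv (\<Sum>x\<in>P. f x) = (\<Sum>x\<in>P. pderiv (f x))" for f :: "'a \<Rightarrow> int poly"
    by (induction P rule: infinite_finite_induct) (simp_all add: pderiv_add)
  have "int (\<Sum>x\<in>P. kappa P x) = int (\<Sum>x\<in>P. iota P x)"
    by (simp only: sum_kappa_eq_sum_iota[OF assms])
  then have "[:-1, 1:]\<^sup>2 dvd upper_cov_poly P - lower_cov_poly P"
    by (intro double_root_one_dvd)
       (simp_all add: upper_cov_poly_def lower_cov_poly_def poly_sum poly_monom
          pderiv_diff pderiv_sum pderiv_monom)
  then obtain D where D: "upper_cov_poly P - lower_cov_poly P = [:-1, 1:]\<^sup>2 * D"
    by (rule dvdE)
  then show ?thesis by (simp only: deviation_poly_eqI[OF D])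
qed

lemma finite_pos_roots_B: "finite (pos_roots_B n)"
proof -
  have "pos_roots_B n \<subseteq>
      (\<lambda>(i, j). eps i - eps j) ` ({..n} \<times> {..n}) \<union>
      (\<lambda>(i, j). eps i + eps j) ` ({..n} \<times> {..n}) \<union> eps ` {..n}"
    by (fastforce simp: pos_roots_B_def)
  then show ?thesis by (rule finite_subset) auto
qed

lemma finite_Ab_B: "finite (Ab_B n)"
proof (rule finite_subset)
  show "Ab_B n \<subseteq> Pow (pos_roots_B n)"
    by (auto simp: Ab_B_def upper_ideal_B_def)
qed (simp add: finite_pos_roots_B)

text \<open>
  The lower index is an integer so that it can be negative (truncated subtraction on
  \<^typ>\<open>nat\<close> would turn \<open>-1\<close> into \<open>0\<close>). For \<open>n \<ge> 2\<close> all the binomial coefficients in the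
  theorem vanish when \<open>k > n\<close>, so that its sums over \<open>k \<le> n\<close> are the sums over all
  \<open>k \<ge> 0\<close>.
\<close>

definition binom :: "nat \<Rightarrow> int \<Rightarrow> int" where
  "binom m j = (if j < 0 then 0 else int (m choose nat j))"

end

theory Submission
  imports Defs
begin

text \<open>
  The abelian ideals correspond to the strict partitions \<open>\<lambda>\<^sub>1 > \<lambda>\<^sub>2 > \<dots>\<close> with either
  \<open>\<lambda>\<^sub>1 \<le> 2n - 1\<close> and \<open>\<lambda>\<^sub>2 = 0\<close>, or \<open>\<lambda>\<^sub>1 + \<lambda>\<^sub>2 \<le> 2n - 2\<close>; inclusion of ideals is inclusion of
  shifted diagrams, so coverings add or remove one box. Hence \<open>\<kappa>\<close> counts the maximal runs of
  consecutive parts, and \<open>\<iota>\<close> counts the runs of the complement, up to a boundary correction.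
  Either \<open>\<lambda>\<close> is an arbitrary set of parts in \<open>{1..n-1}\<close>, or \<open>\<lambda>\<^sub>1 = 2n - 1 - r\<close> with \<open>r < n\<close>
  and the other parts form an arbitrary subset of \<open>{1..r-1}\<close>. Subsets of an interval are counted
  by runs with Pascal's rule, and the sum over \<open>r\<close> is a hockey-stick sum.
\<close>

section \<open>The root diagram\<close>

text \<open>For \<open>1 \<le> k \<le> n\<close> and a vector supported on \<open>{1..n}\<close>,
  this is the coefficient of the \<open>k\<close>-th simple root, so no step up in the root order
  decreases it.\<close>

definition psum :: "nat \<Rightarrow> (nat \<Rightarrow> int) \<Rightarrow> int" where
  "psum k f = (\<Sum>j\<le>k. f j)"

lemma psum_add: "psum k (f + g) = psum k f + psum k g"
  and psum_diff: "psum k (f - g) = psum k f - psum k g"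
  and psum_zero: "psum k 0 = 0"
  and psum_uminus: "psum k (- f) = - psum k f"
  by (simp_all add: psum_def sum.distrib sum_subtractf sum_negf)

lemma psum_eps: "psum k (eps i) = (if i \<le> k then 1 else 0)"
  by (simp add: psum_def eps_def)

text \<open>
  Row \<open>i\<close> of the root diagram lists the roots with leading term \<open>eps i\<close> by increasing depth
  below the highest root \<open>eps 1 + eps 2\<close>, which sits in box \<open>(1, 1)\<close>. Larger roots have smaller
  coordinates, so upper ideals become down-closed sets of boxes.
\<close>

definition boxes :: "nat \<Rightarrow> (nat \<times> nat) set" where
  "boxes n = {(i, c). 1 \<le> i \<and> i \<le> c \<and> i + c \<le> 2 * n}"

text \<open>Columns \<open>1\<close> to \<open>2 * n - 1\<close> carry
  \<open>eps 2, ..., eps n, 0, - eps n, ..., - eps 2\<close>; consecutive entries differ by a simple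
  root.\<close>

definition tail_root :: "nat \<Rightarrow> nat \<Rightarrow> nat \<Rightarrow> int" where
  "tail_root n c =
     (if c < n then eps (c + 1) else if c = n then 0 else - eps (2 * n + 1 - c))"

definition box_root :: "nat \<Rightarrow> nat \<times> nat \<Rightarrow> nat \<Rightarrow> int" where
  "box_root n = (\<lambda>(i, c). eps i + tail_root n c)"

lemma box_root_image: "box_root n ` boxes n = pos_roots_B n"
proof (intro equalityI subsetI)
  fix x assume "x \<in> box_root n ` boxes n"
  then obtain i c where b: "1 \<le> i" "i \<le> c" "i + c \<le> 2 * n" and x: "x = eps i + tail_root n c"
    by (auto simp: boxes_def box_root_def)
  consider "c < n" | "c = n" | "c > n" by linarith
  then show "x \<in> pos_roots_B n"
  proof cases
    case 1
    then have "x = eps i + eps (c + 1) \<and> 1 \<le> i \<and> i < c + 1 \<and> c + 1 \<le> n"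
      using b by (simp add: x tail_root_def)
    then show ?thesis unfolding pos_roots_B_def by blast
  next
    case 2
    then have "x = eps i \<and> 1 \<le> i \<and> i \<le> n"
      using b by (simp add: x tail_root_def)
    then show ?thesis unfolding pos_roots_B_def by blast
  next
    case 3
    then have "x = eps i - eps (2 * n + 1 - c) \<and> 1 \<le> i \<and> i < 2 * n + 1 - c \<and> 2 * n + 1 - c \<le> n"
      using b by (auto simp: x tail_root_def)
    then show ?thesis unfolding pos_roots_B_def by blast
  qed
next
  fix x assume "x \<in> pos_roots_B n"
  then consider (minus) i j where "x = eps i - eps j" "1 \<le> i" "i < j" "j \<le> n"
    | (plus) i j where "x = eps i + eps j" "1 \<le> i" "i < j" "j \<le> n"
    | (short) i where "x = eps i" "1 \<le> i" "i \<le> n"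
    unfolding pos_roots_B_def by blast
  then show "x \<in> box_root n ` boxes n"
  proof cases
    case minus
    then have "x = box_root n (i, 2 * n + 1 - j)" "(i, 2 * n + 1 - j) \<in> boxes n"
      by (auto simp: box_root_def tail_root_def boxes_def)
    then show ?thesis by blast
  next
    case plus
    then have "x = box_root n (i, j - 1)" "(i, j - 1) \<in> boxes n"
      by (auto simp: box_root_def tail_root_def boxes_def)
    then show ?thesis by blast
  next
    case short
    then have "x = box_root n (i, n)" "(i, n) \<in> boxes n"
      by (auto simp: box_root_def tail_root_def boxes_def)
    then show ?thesis by blast
  qed
qed

lemma psum_box_root:
  assumes "k \<le> n" "c < 2 * n"
  shows "psum k (box_root n (i, c)) =
    (if i \<le> k then 1 else 0) +
    (if c < n then (if c < k then 1 else 0) else (if 2 * n - c < k then - 1 else 0))"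
  using assms
  by (auto simp: box_root_def tail_root_def psum_add psum_uminus psum_zero psum_eps)

text \<open>One value of \<open>k\<close> detects each coordinate. At \<open>k = i\<close> the first
  root has sum 1, which the second reaches only if its leading term has entered. For columns,
  \<open>k = c + 1\<close> (if \<open>c < n\<close>) gives the first root sum 2, and otherwise
  \<open>k = 2 * n - c\<close> gives sum 1, with no negative tail entered yet; \<open>c < c'\<close>
  would make the second sum smaller.\<close>

lemma box_le_if_psum_le:
  assumes b: "(i, c) \<in> boxes n" "(i', c') \<in> boxes n"
    and le: "\<And>k. k \<le> n \<Longrightarrow> psum k (box_root n (i, c)) \<le> psum k (box_root n (i', c'))"
  shows "i' \<le> i \<and> c' \<le> c"
proof
  have lt: "c < 2 * n" "c' < 2 * n" and i: "i \<le> n"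
    using b by (auto simp: boxes_def)
  show "i' \<le> i"
    using le[OF i] b by (auto simp: boxes_def psum_box_root[OF i] lt split: if_splits)
  show "c' \<le> c"
  proof (cases "c < n")
    case True
    then have k: "Suc c \<le> n" by simp
    show ?thesis
      using le[OF k] b True by (auto simp: boxes_def psum_box_root[OF k] lt split: if_splits)
  next
    case False
    then have k: "2 * n - c \<le> n" by simp
    show ?thesis
      using le[OF k] b False by (auto simp: boxes_def psum_box_root[OF k] lt split: if_splits)
  qed
qed

lemma inj_on_box_root: "inj_on (box_root n) (boxes n)"
proof (rule inj_onI)
  fix b b' assume *: "b \<in> boxes n" "b' \<in> boxes n" "box_root n b = box_root n b'"
  obtain i c i' c' where "b = (i, c)" "b' = (i', c')" by fastforce
  with * show "b = b'"
    using box_le_if_psum_le[of i c n i' c'] box_le_if_psum_le[of i' c' n i c] by simp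
qed

section \<open>The root order in box coordinates\<close>

lemma psum_simple_root_nonneg: "\<alpha> \<in> simple_roots_B n \<Longrightarrow> 0 \<le> psum k \<alpha>"
  by (auto simp: simple_roots_B_def psum_diff psum_eps)

lemma psum_mono_root_le:
  assumes "root_le_B n \<mu> \<gamma>"
  shows "psum k \<mu> \<le> psum k \<gamma>"
  using assms unfolding root_le_B_def
proof (induction rule: rtranclp_induct)
  case (step \<gamma> \<delta>)
  then have "0 \<le> psum k (\<delta> - \<gamma>)"
    by (intro psum_simple_root_nonneg[of _ n]) (simp add: root_step_B_def)
  with step.IH show ?case by (simp add: psum_diff)
qed simp

lemma root_step_row:
  assumes "(Suc i, c) \<in> boxes n" "1 \<le> i"
  shows "root_step_B n (box_root n (Suc i, c)) (box_root n (i, c))"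
proof -
  have "box_root n (i, c) - box_root n (Suc i, c) = eps i - eps (i + 1)"
    by (simp add: box_root_def)
  moreover have "i < n" "(i, c) \<in> boxes n" using assms by (auto simp: boxes_def)
  ultimately show ?thesis
    using assms box_root_image[of n] by (auto simp: root_step_B_def simple_roots_B_def)
qed

lemma root_step_column:
  assumes "(i, Suc c) \<in> boxes n" "i \<le> c"
  shows "root_step_B n (box_root n (i, Suc c)) (box_root n (i, c))"
proof -
  have b: "(i, c) \<in> boxes n" using assms by (auto simp: boxes_def)
  have d: "box_root n (i, c) - box_root n (i, Suc c) = tail_root n c - tail_root n (Suc c)"
    by (simp add: box_root_def)
  consider "Suc c < n" | "Suc c = n" | "c = n" | "n < c" by linarith
  then have "tail_root n c - tail_root n (Suc c) \<in> simple_roots_B n"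
  proof cases
    case 1
    have "1 \<le> c + 1" "c + 1 < n" using 1 by auto
    moreover have "tail_root n c - tail_root n (Suc c) = eps (c + 1) - eps (c + 1 + 1)"
      using 1 by (simp add: tail_root_def)
    ultimately show ?thesis unfolding simple_roots_B_def by blast
  next
    case 4
    \<comment> \<open>In the negative half the tails of columns \<open>c\<close> and
      \<open>Suc c\<close> are \<open>- eps (?k + 1)\<close> and \<open>- eps ?k\<close>.\<close>
    let ?k = "2 * n - c"
    have k: "1 \<le> ?k" "?k < n" using 4 assms by (auto simp: boxes_def)
    have "2 * n + 1 - Suc c = ?k" "2 * n + 1 - c = ?k + 1" using k by auto
    then have "tail_root n c - tail_root n (Suc c) = eps ?k - eps (?k + 1)"
      using 4 by (simp add: tail_root_def)
    with k show ?thesis unfolding simple_roots_B_def by blast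
  qed (auto simp: tail_root_def simple_roots_B_def)
  with b assms d show ?thesis
    using box_root_image[of n] by (auto simp: root_step_B_def)
qed

text \<open>Partial sums give one direction. For the other, a chain of simple steps first lowers the
  row index and then the column index; in this order all intermediate boxes satisfy row \<le>
  column.\<close>

lemma root_le_box_root:
  assumes b: "(i, c) \<in> boxes n" and b': "(i', c') \<in> boxes n"
  shows "root_le_B n (box_root n (i, c)) (box_root n (i', c')) \<longleftrightarrow> i' \<le> i \<and> c' \<le> c"
proof
  assume "root_le_B n (box_root n (i, c)) (box_root n (i', c'))"
  then show "i' \<le> i \<and> c' \<le> c"
    by (intro box_le_if_psum_le[OF b b'] psum_mono_root_le)
next
  assume "i' \<le> i \<and> c' \<le> c"
  then have i: "i' \<le> i" and c: "c' \<le> c" by auto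
  have 1: "1 \<le> i'" "i' \<le> c'" using b' by (auto simp: boxes_def)
  have "root_le_B n (box_root n (i, c)) (box_root n (i', c))"
    using i b
  proof (induction i rule: dec_induct)
    case base
    show ?case by (simp add: root_le_B_def)
  next
    case (step j)
    then have "root_le_B n (box_root n (j, c)) (box_root n (i', c))"
      using 1 by (auto simp: boxes_def)
    moreover have "root_step_B n (box_root n (Suc j, c)) (box_root n (j, c))"
      using step 1 by (intro root_step_row) auto
    ultimately show ?case unfolding root_le_B_def by (meson converse_rtranclp_into_rtranclp)
  qed
  moreover have "(i', c) \<in> boxes n" using b i 1 by (auto simp: boxes_def)
  with c have "root_le_B n (box_root n (i', c)) (box_root n (i', c'))"
  proof (induction c rule: dec_induct)
    case base
    show ?case by (simp add: root_le_B_def)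
  next
    case (step d)
    then have "root_le_B n (box_root n (i', d)) (box_root n (i', c'))"
      using 1 by (auto simp: boxes_def)
    moreover have "root_step_B n (box_root n (i', Suc d)) (box_root n (i', d))"
      using step 1 by (intro root_step_column) auto
    ultimately show ?case unfolding root_le_B_def by (meson converse_rtranclp_into_rtranclp)
  qed
  ultimately show "root_le_B n (box_root n (i, c)) (box_root n (i', c'))"
    unfolding root_le_B_def by (rule rtranclp_trans)
qed

section \<open>Abelian ideals as sets of boxes\<close>

definition down_closed :: "(nat \<times> nat) set \<Rightarrow> bool" where
  "down_closed D \<longleftrightarrow>
     (\<forall>i c i' c'. (i, c) \<in> D \<longrightarrow> 1 \<le> i' \<longrightarrow> i' \<le> i \<longrightarrow> i' \<le> c' \<longrightarrow> c' \<le> c \<longrightarrow> (i', c') \<in> D)"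

lemma down_closedD:
  assumes "down_closed D" "(i, c) \<in> D" "1 \<le> i'" "i' \<le> i" "i' \<le> c'" "c' \<le> c"
  shows "(i', c') \<in> D"
  using assms unfolding down_closed_def by blast

lemma upper_ideal_box_root:
  assumes "D \<subseteq> boxes n"
  shows "upper_ideal_B n (box_root n ` D) \<longleftrightarrow> down_closed D"
proof
  assume u: "upper_ideal_B n (box_root n ` D)"
  show "down_closed D"
    unfolding down_closed_def
  proof (intro allI impI)
    fix i c i' c'
    assume D: "(i, c) \<in> D" and le: "1 \<le> i'" "i' \<le> i" "i' \<le> c'" "c' \<le> c"
    have b: "(i, c) \<in> boxes n" using D assms by blast
    with le have b': "(i', c') \<in> boxes n" by (auto simp: boxes_def)
    then have "box_root n (i', c') \<in> box_root n ` D"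
      using u D le root_le_box_root[OF b b'] box_root_image[of n]
      unfolding upper_ideal_B_def by blast
    then show "(i', c') \<in> D"
      using inj_on_image_mem_iff[OF inj_on_box_root b' assms] by blast
  qed
next
  assume d: "down_closed D"
  show "upper_ideal_B n (box_root n ` D)"
    unfolding upper_ideal_B_def
  proof (intro conjI ballI impI)
    show "box_root n ` D \<subseteq> pos_roots_B n"
      using assms box_root_image[of n] by blast
    fix \<mu> \<gamma> assume *: "\<mu> \<in> box_root n ` D" "\<gamma> \<in> pos_roots_B n" "root_le_B n \<mu> \<gamma>"
    from *(1) obtain i c where m: "(i, c) \<in> D" "\<mu> = box_root n (i, c)" by auto
    from *(2) obtain i' c' where g: "(i', c') \<in> boxes n" "\<gamma> = box_root n (i', c')"
      using box_root_image[of n] by force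
    have "(i, c) \<in> boxes n" using m assms by blast
    then have "i' \<le> i \<and> c' \<le> c"
      using *(3) m g by (simp add: root_le_box_root)
    moreover have "1 \<le> i'" "i' \<le> c'" using g by (auto simp: boxes_def)
    ultimately have "(i', c') \<in> D" using down_closedD[OF d m(1)] by blast
    with g show "\<gamma> \<in> box_root n ` D" by blast
  qed
qed

lemma psum_pos_root_le: "\<gamma> \<in> pos_roots_B n \<Longrightarrow> psum k \<gamma> \<le> 2"
  by (auto simp: pos_roots_B_def psum_add psum_diff psum_eps)

lemma pos_root_le_1: "\<gamma> \<in> pos_roots_B n \<Longrightarrow> \<gamma> i \<le> 1"
  by (auto simp: pos_roots_B_def eps_def)

lemma box_root_at_row: "(i, c) \<in> boxes n \<Longrightarrow> box_root n (i, c) i = 1"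
  by (auto simp: boxes_def box_root_def tail_root_def eps_def)

lemma box_root_add_not_root:
  assumes b: "(i, c) \<in> boxes n" "(i', c') \<in> boxes n" and "i < i'" "c + c' < 2 * n"
  shows "box_root n (i, c) + box_root n (i', c') \<notin> pos_roots_B n"
proof
  let ?v = "box_root n (i, c) + box_root n (i', c')"
  assume "?v \<in> pos_roots_B n"
  then have le2: "psum k ?v \<le> 2" for k
    by (rule psum_pos_root_le)
  have bnd: "c < 2 * n" "c' < 2 * n" using b by (auto simp: boxes_def)
  \<comment> \<open>The last index at which neither root has a negative tail. Both leading terms
    have entered by then, and \<open>c + c' < 2 * n\<close> forces at least one positive tail to
    have entered as well.\<close>
  define k where "k = min n (2 * n - max c c')"
  have k: "k \<le> n" by (simp add: k_def)
  have "3 \<le> psum k ?v"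
    using assms unfolding psum_add psum_box_root[OF k bnd(1)] psum_box_root[OF k bnd(2)]
    by (auto simp: k_def boxes_def max_def min_def)
  with le2[of k] show False by simp
qed

text \<open>
  \<open>tail_root n (2 * n - c) = - tail_root n c\<close>, so boxes in two different rows whose columns
  add up to \<open>2 * n\<close> have a root as their sum. When the columns add up to less, some partial sum
  of the sum is at least 3, whereas no root exceeds 2.
\<close>

lemma abelian_box_root:
  assumes D: "D \<subseteq> boxes n" and d: "down_closed D"
  shows "abelian_B n (box_root n ` D) \<longleftrightarrow>
    (\<forall>c c'. (1, c) \<in> D \<longrightarrow> (2, c') \<in> D \<longrightarrow> c + c' < 2 * n)"
proof
  assume a: "abelian_B n (box_root n ` D)"
  show "\<forall>c c'. (1, c) \<in> D \<longrightarrow> (2, c') \<in> D \<longrightarrow> c + c' < 2 * n"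
  proof (intro allI impI, rule ccontr)
    fix c c' assume *: "(1, c) \<in> D" "(2, c') \<in> D" "\<not> c + c' < 2 * n"
    have c': "2 \<le> c'" "2 + c' \<le> 2 * n" using * D by (auto simp: boxes_def)
    have "(1, 2 * n - c') \<in> D"
      using d by (rule down_closedD[OF _ *(1)]) (use * c' in auto)
    moreover have "tail_root n (2 * n - c') = - tail_root n c'"
      using c' by (auto simp: tail_root_def Suc_diff_le)
    then have "box_root n (1, 2 * n - c') + box_root n (2, c') = eps 1 + eps 2"
      by (simp add: box_root_def)
    moreover have "(1::nat) < 2" "2 \<le> n" using c' by auto
    then have "eps 1 + eps 2 \<in> pos_roots_B n"
      unfolding pos_roots_B_def by blast
    ultimately show False using a * unfolding abelian_B_def by (metis imageI)
  qed
next
  assume r: "\<forall>c c'. (1, c) \<in> D \<longrightarrow> (2, c') \<in> D \<longrightarrow> c + c' < 2 * n"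
  have lt: "box_root n (i, c) + box_root n (i', c') \<notin> pos_roots_B n"
    if "(i, c) \<in> D" "(i', c') \<in> D" "i < i'" for i c i' c'
  proof -
    have b: "1 \<le> i" "i \<le> c" "i' \<le> c'"
      using D that by (auto simp: boxes_def)
    \<comment> \<open>Down-closure moves the two boxes up to rows 1 and 2 without changing columns,
      where the assumption on \<open>D\<close> applies.\<close>
    have "(1, c) \<in> D"
      by (rule down_closedD[OF d that(1)]) (use b in auto)
    moreover have "(2, c') \<in> D"
      by (rule down_closedD[OF d that(2)]) (use b that(3) in auto)
    ultimately show ?thesis using r that D by (intro box_root_add_not_root) auto
  qed
  \<comment> \<open>Two roots from the same row add up to 2 in their leading coordinate.\<close>
  have eq: "box_root n (i, c) + box_root n (i, c') \<notin> pos_roots_B n"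
    if "(i, c) \<in> D" "(i, c') \<in> D" for i c c'
  proof
    let ?v = "box_root n (i, c) + box_root n (i, c')"
    assume "?v \<in> pos_roots_B n"
    then have "?v i \<le> 1" by (rule pos_root_le_1)
    moreover have "?v i = 2"
      using box_root_at_row[of i _ n] that D by (simp add: subset_iff)
    ultimately show False by simp
  qed
  show "abelian_B n (box_root n ` D)"
    unfolding abelian_B_def
  proof (intro ballI)
    fix x y assume "x \<in> box_root n ` D" "y \<in> box_root n ` D"
    then obtain i c i' c' where "(i, c) \<in> D" "(i', c') \<in> D"
      "x = box_root n (i, c)" "y = box_root n (i', c')" by auto
    then show "x + y \<notin> pos_roots_B n"
      using lt[of i c i' c'] lt[of i' c' i c] eq[of i c c']
      by (cases i i' rule: linorder_cases) (auto simp: add.commute)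
  qed
qed

definition abelian_diagrams :: "nat \<Rightarrow> (nat \<times> nat) set set" where
  "abelian_diagrams n = {D. D \<subseteq> boxes n \<and> down_closed D \<and>
     (\<forall>c c'. (1, c) \<in> D \<longrightarrow> (2, c') \<in> D \<longrightarrow> c + c' < 2 * n)}"

lemma Ab_B_eq: "Ab_B n = (`) (box_root n) ` abelian_diagrams n"
proof (intro equalityI subsetI)
  fix I assume I: "I \<in> Ab_B n"
  then have "I \<subseteq> box_root n ` boxes n"
    by (simp add: Ab_B_def upper_ideal_B_def box_root_image)
  then obtain D where "D \<subseteq> boxes n" "I = box_root n ` D"
    by (auto simp: subset_image_iff)
  with I show "I \<in> (`) (box_root n) ` abelian_diagrams n"
    by (auto simp: Ab_B_def abelian_diagrams_def upper_ideal_box_root abelian_box_root)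
qed (auto simp: Ab_B_def abelian_diagrams_def upper_ideal_box_root abelian_box_root)

section \<open>Runs in subsets of an interval\<close>

text \<open>Maximal blocks of consecutive elements, counted by their least elements. The case
  \<open>t = 0\<close> is separate because the truncated \<open>0 - 1\<close> is \<open>0\<close>
  itself.\<close>

definition runs :: "nat set \<Rightarrow> nat" where
  "runs U = card {t \<in> U. t = 0 \<or> t - 1 \<notin> U}"

definition run_poly :: "nat \<Rightarrow> int poly" where
  "run_poly m = (\<Sum>U\<in>Pow {..<m}. monom 1 (runs U))"

text \<open>Restricts to the subsets of \<open>{..m}\<close> that contain \<open>m\<close>: whether
  a further last element opens a new run depends only on its predecessor, so the two polynomials
  satisfy a joint recursion.\<close>

definition run_poly_last :: "nat \<Rightarrow> int poly" where
  "run_poly_last m = (\<Sum>U\<in>Pow {..<m}. monom 1 (runs (insert m U)))"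

lemma runs_insert_separated:
  assumes "finite U" "M \<notin> U" "Suc M \<notin> U" "0 < M" "M - 1 \<notin> U"
  shows "runs (insert M U) = Suc (runs U)"
proof -
  have "{t \<in> insert M U. t = 0 \<or> t - 1 \<notin> insert M U} = insert M {t \<in> U. t = 0 \<or> t - 1 \<notin> U}"
    using assms by auto
  then show ?thesis using assms by (simp add: runs_def)
qed

lemma runs_insert_adjacent:
  assumes "m \<in> U" "Suc m \<notin> U" "Suc (Suc m) \<notin> U"
  shows "runs (insert (Suc m) U) = runs U"
proof -
  have "{t \<in> insert (Suc m) U. t = 0 \<or> t - 1 \<notin> insert (Suc m) U} = {t \<in> U. t = 0 \<or> t - 1 \<notin> U}"
    using assms by (auto simp: gr0_conv_Suc)
  then show ?thesis by (simp add: runs_def)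
qed

lemma sum_Pow_lessThan_Suc:
  "(\<Sum>U\<in>Pow {..<Suc m}. f U) = (\<Sum>U\<in>Pow {..<m}. f U) + (\<Sum>U\<in>Pow {..<m}. f (insert m U))"
proof -
  have "inj_on (insert m) (Pow {..<m})"
    by (rule inj_onI) (auto simp: insert_eq_iff subset_iff)
  moreover have "Pow {..<m} \<inter> insert m ` Pow {..<m} = {}" by auto
  ultimately show ?thesis
    by (simp add: lessThan_Suc Pow_insert sum.union_disjoint sum.reindex)
qed

lemma run_poly_Suc: "run_poly (Suc m) = run_poly m + run_poly_last m"
  unfolding run_poly_def run_poly_last_def by (rule sum_Pow_lessThan_Suc)

text \<open>If \<open>m\<close> is absent, \<open>Suc m\<close> opens a new run and contributes a
  factor \<open>q\<close>; if \<open>m\<close> is present, it prolongs the last run.\<close>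

lemma run_poly_last_Suc: "run_poly_last (Suc m) = monom 1 1 * run_poly m + run_poly_last m"
proof -
  have "runs (insert (Suc m) U) = Suc (runs U)" if "U \<subseteq> {..<m}" for U
    using that finite_subset[OF that] by (intro runs_insert_separated) auto
  moreover have "runs (insert (Suc m) (insert m U)) = runs (insert m U)" if "U \<subseteq> {..<m}" for U
    using that by (intro runs_insert_adjacent) auto
  ultimately show ?thesis
    by (simp add: run_poly_last_def run_poly_def sum_Pow_lessThan_Suc sum_distrib_left mult_monom)
qed

section \<open>Binomial sums and the count of subsets by runs\<close>

lemma binom_Suc: "binom (Suc m) j = binom m j + binom m (j - 1)"
proof (cases "j \<le> 0")
  case False
  then have "nat j = Suc (nat (j - 1))" by simp
  with False show ?thesis by (simp add: binom_def)
qed (auto simp: binom_def)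

text \<open>Hockey-stick identity. At \<open>j = -1\<close> the left side is 0 although
  \<open>binom m 0 = 1\<close>, hence the correction.\<close>

lemma sum_binom: "(\<Sum>s<m. binom s j) = binom m (j + 1) - (if j = -1 then 1 else 0)"
proof (induction m)
  case (Suc m)
  then show ?case by (simp add: binom_Suc)
qed (auto simp: binom_def)

lemma binom_0: "binom 0 j = (if j = 0 then 1 else 0)"
  by (auto simp: binom_def)

lemma binom_neg: "j < 0 \<Longrightarrow> binom m j = 0"
  by (simp add: binom_def)

lemma binom_eq_0: "int m < j \<Longrightarrow> binom m j = 0"
  by (simp add: binom_def)

lemma coeff_monom_1_mult:
  fixes p :: "int poly"
  shows "coeff (monom 1 (Suc 0) * p) k = (if k = 0 then 0 else coeff p (k - 1))"
  by (simp add: coeff_monom_mult)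

text \<open>A subset with \<open>k\<close> runs is determined by its \<open>2k\<close> boundaries
  among \<open>m + 1\<close> gaps; if the last element is forced, one boundary is fixed. The
  induction matches the two recursions with Pascal's rule for even and odd lower indices.\<close>

lemma coeff_run_poly:
  "coeff (run_poly m) k = binom (Suc m) (2 * int k)"
  "coeff (run_poly_last m) k = binom (Suc m) (2 * int k - 1)"
proof (induction m arbitrary: k)
  case 0
  have "{t \<in> {0}. t = 0 \<or> t - 1 \<notin> {0}} = {0::nat}" by auto
  then have "runs {} = 0" "runs {0} = 1" by (simp_all add: runs_def)
  { case 1 from \<open>runs {} = 0\<close> show ?case
      by (simp add: run_poly_def binom_Suc binom_0) }
  { case 2 from \<open>runs {0} = 1\<close> show ?case
      by (simp add: run_poly_last_def binom_Suc binom_0) }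
next
  case (Suc m)
  { case 1 from Suc show ?case by (simp add: run_poly_Suc binom_Suc[of "Suc m"]) }
  { case 2 show ?case
    proof (cases k)
      case 0
      with Suc show ?thesis by (simp add: run_poly_last_Suc coeff_monom_1_mult binom_neg)
    next
      case (Suc j)
      have "binom (Suc (Suc m)) (2 * int k - 1) = binom (Suc m) (2 * int k - 1) + binom (Suc m) (2 * int j)"
        using binom_Suc[of "Suc m" "2 * int k - 1"] Suc by simp
      then show ?thesis
        using Suc Suc.IH by (simp add: run_poly_last_Suc coeff_monom_1_mult)
    qed }
qed

text \<open>Complementation permutes the subsets; this is needed because addable boxes are counted
  by runs of a complement.\<close>

lemma run_poly_compl: "(\<Sum>U\<in>Pow {..<m}. monom 1 (runs ({..<m} - U))) = run_poly m"
  unfolding run_poly_def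
  by (rule sum.reindex_bij_witness[of _ "\<lambda>U. {..<m} - U" "\<lambda>U. {..<m} - U"])
     (auto simp: double_diff)

lemma run_poly_last_compl: "(\<Sum>U\<in>Pow {..<m}. monom 1 (runs ({..<Suc m} - U))) = run_poly_last m"
  unfolding run_poly_last_def
proof (rule sum.reindex_bij_witness[of _ "\<lambda>U. {..<m} - U" "\<lambda>U. {..<m} - U"])
  fix U assume "U \<in> Pow {..<m}"
  then have "insert m ({..<m} - U) = {..<Suc m} - U" by auto
  then show "monom 1 (runs (insert m ({..<m} - U))) = (monom 1 (runs ({..<Suc m} - U)) :: int poly)"
    by simp
qed (auto simp: double_diff)

section \<open>Strict partitions and coverings\<close>

text \<open>
  \<open>U\<close> encodes the shifted diagram of the strict partition with parts \<open>u + 1\<close>, \<open>u \<in> U\<close>;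
  \<open>tcount U t\<close> is the length of its diagonal \<open>c - i = t\<close>.
\<close>

definition tcount :: "nat set \<Rightarrow> nat \<Rightarrow> nat" where
  "tcount U t = card {u \<in> U. t \<le> u}"

lemma tcount_Suc:
  assumes "finite U"
  shows "tcount U t = tcount U (Suc t) + (if t \<in> U then 1 else 0)"
proof (cases "t \<in> U")
  case True
  then have "{u \<in> U. t \<le> u} = insert t {u \<in> U. Suc t \<le> u}" by auto
  with True assms show ?thesis by (simp add: tcount_def)
next
  case False
  then have "{u \<in> U. t \<le> u} = {u \<in> U. Suc t \<le> u}"
    by (auto simp: Suc_le_eq order_le_less)
  with False show ?thesis by (simp add: tcount_def)
qed

text \<open>Successive diagonals lose at most one box, and lengths never increase with
  \<open>t\<close>; the truncated difference covers both cases.\<close>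

lemma tcount_le_add_diff:
  assumes "finite U"
  shows "tcount U s \<le> tcount U t + (t - s)"
proof (cases "s \<le> t")
  case True
  then show ?thesis
  proof (induction t rule: dec_induct)
    case (step t)
    then show ?case
      using tcount_Suc[OF assms, of t] by (cases "t \<in> U") (simp_all add: Suc_diff_le)
  qed simp
next
  case False
  then have "tcount U s \<le> tcount U t"
    unfolding tcount_def using assms by (intro card_mono) auto
  then show ?thesis by simp
qed

lemma tcount_inject:
  assumes "finite U" "finite V" "\<And>t. tcount U t = tcount V t"
  shows "U = V"
proof (rule set_eqI)
  fix t
  show "t \<in> U \<longleftrightarrow> t \<in> V"
    using tcount_Suc[OF assms(1), of t] tcount_Suc[OF assms(2), of t] assms(3)
    by (auto split: if_splits)
qed

lemma tcount_ge_1: "finite U \<Longrightarrow> 1 \<le> tcount U t \<longleftrightarrow> (\<exists>u\<in>U. t \<le> u)"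
  by (auto simp: tcount_def Suc_le_eq card_gt_0_iff)

lemma tcount_ge_2:
  assumes "finite U"
  shows "2 \<le> tcount U t \<longleftrightarrow> (\<exists>u\<in>U. \<exists>v\<in>U. t \<le> u \<and> u < v)"
proof -
  have "2 \<le> tcount U t \<longleftrightarrow> \<not> card {u \<in> U. t \<le> u} \<le> Suc 0"
    by (auto simp: tcount_def)
  also have "\<dots> \<longleftrightarrow> (\<exists>u\<in>U. \<exists>v\<in>U. t \<le> u \<and> t \<le> v \<and> u \<noteq> v)"
    using assms by (subst card_le_Suc0_iff_eq) auto
  also have "\<dots> \<longleftrightarrow> (\<exists>u\<in>U. \<exists>v\<in>U. t \<le> u \<and> u < v)"
    by (metis less_imp_le_nat less_imp_neq linorder_neqE_nat order.trans)
  finally show ?thesis .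
qed

text \<open>Since \<open>t\<close> stands for the part \<open>t + 1\<close>, the bounds say that
  parts are at most \<open>2n - 1\<close> and that two different parts sum to at most
  \<open>2n - 2\<close>; for the sum, the two largest parts decide.\<close>

definition codes :: "nat \<Rightarrow> nat set set" where
  "codes n = {U. \<forall>t\<in>U. t + 2 \<le> 2 * n \<and> (\<forall>s\<in>U. s < t \<longrightarrow> s + t + 4 \<le> 2 * n)}"

lemma finite_code: "U \<in> codes n \<Longrightarrow> finite U"
  by (rule finite_subset[of _ "{..2 * n}"]) (auto simp: codes_def)

text \<open>Expresses the bounds through diagonal lengths in a monotone way, so that a code stays a
  code when its diagram shrinks.\<close>

lemma codes_iff_tcount:
  assumes "finite U"
  shows "U \<in> codes n \<longleftrightarrow> (\<forall>t. 1 \<le> tcount U t \<longrightarrow> t + 2 \<le> 2 * n) \<and>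
    (\<forall>s t. 1 \<le> tcount U t \<longrightarrow> 2 \<le> tcount U s \<longrightarrow> s + t + 4 \<le> 2 * n)"
    (is "_ \<longleftrightarrow> ?one \<and> ?two")
proof
  assume U: "U \<in> codes n"
  have ?one using U unfolding tcount_ge_1[OF assms] codes_def by fastforce
  moreover have ?two
    unfolding tcount_ge_1[OF assms] tcount_ge_2[OF assms]
  proof (intro allI impI)
    fix s t assume "\<exists>u\<in>U. t \<le> u" "\<exists>u\<in>U. \<exists>v\<in>U. s \<le> u \<and> u < v"
    then obtain u a b where *: "u \<in> U" "t \<le> u" "a \<in> U" "b \<in> U" "s \<le> a" "a < b" by blast
    \<comment> \<open>\<open>u\<close> may coincide with \<open>b\<close> or lie below
      \<open>a\<close>; the pair \<open>a, u\<close> or the pair \<open>a, b\<close> dominates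
      \<open>s, t\<close>.\<close>
    then have "a + b + 4 \<le> 2 * n" "a < u \<Longrightarrow> a + u + 4 \<le> 2 * n"
      using U by (auto simp: codes_def)
    with * show "s + t + 4 \<le> 2 * n" by (cases "a < u") auto
  qed
  ultimately show "?one \<and> ?two" ..
next
  assume "?one \<and> ?two"
  then show "U \<in> codes n"
    unfolding tcount_ge_1[OF assms] tcount_ge_2[OF assms] codes_def by blast
qed

lemma codes_mono:
  assumes "V \<in> codes n" "finite U" "\<And>t. tcount U t \<le> tcount V t"
  shows "U \<in> codes n"
  using assms(1) assms(3)
  unfolding codes_iff_tcount[OF assms(2)] codes_iff_tcount[OF finite_code[OF assms(1)]]
  by (meson order_trans)

text \<open>Row \<open>i\<close> starts at \<open>(i, i)\<close> and has the \<open>i\<close>-th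
  largest part as its length: box \<open>(i, c)\<close> is present when at least \<open>i\<close>
  parts reach diagonal \<open>c - i\<close>.\<close>

definition diagram :: "nat set \<Rightarrow> (nat \<times> nat) set" where
  "diagram U = {(i, c). 1 \<le> i \<and> i \<le> c \<and> i \<le> tcount U (c - i)}"

lemma diagram_subset_iff: "diagram U \<subseteq> diagram V \<longleftrightarrow> (\<forall>t. tcount U t \<le> tcount V t)"
proof
  assume sub: "diagram U \<subseteq> diagram V"
  show "\<forall>t. tcount U t \<le> tcount V t"
  proof
    fix t
    let ?i = "tcount U t"
    show "?i \<le> tcount V t"
    proof (cases "?i = 0")
      case False
      \<comment> \<open>The last box of diagonal \<open>t\<close> tests its length.\<close>
      then have "(?i, ?i + t) \<in> diagram U" by (simp add: diagram_def)
      with sub have "(?i, ?i + t) \<in> diagram V" by blast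
      then show ?thesis by (simp add: diagram_def)
    qed simp
  qed
qed (auto simp: diagram_def intro: order_trans)

lemma down_closed_diagram:
  assumes "finite U"
  shows "down_closed (diagram U)"
  unfolding down_closed_def
proof (intro allI impI)
  fix i c i' c'
  assume "(i, c) \<in> diagram U" and *: "1 \<le> i'" "i' \<le> i" "i' \<le> c'" "c' \<le> c"
  then have "i \<le> c" "i \<le> tcount U (c - i)" by (auto simp: diagram_def)
  \<comment> \<open>The diagonal index rises by at most \<open>i - i'\<close>, and each unit costs
    at most one box.\<close>
  moreover have "tcount U (c - i) \<le> tcount U (c' - i') + ((c' - i') - (c - i))"
    by (rule tcount_le_add_diff[OF assms])
  ultimately have "i' \<le> tcount U (c' - i')" using * by linarith
  with * show "(i', c') \<in> diagram U" by (simp add: diagram_def)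
qed

lemma diagram_code:
  assumes "U \<in> codes n"
  shows "diagram U \<in> abelian_diagrams n"
proof -
  have fin: "finite U" using assms by (rule finite_code)
  note down = down_closedD[OF down_closed_diagram[OF fin]]
  have one: "c < 2 * n" if "(1, c) \<in> diagram U" for c
  proof -
    have "1 \<le> c" "1 \<le> tcount U (c - 1)" using that by (auto simp: diagram_def)
    then show ?thesis using assms unfolding codes_iff_tcount[OF fin] by fastforce
  qed
  have two: "c + c' < 2 * n" if "(1, c) \<in> diagram U" "(2, c') \<in> diagram U" for c c'
  proof -
    have "1 \<le> c" "1 \<le> tcount U (c - 1)" "2 \<le> c'" "2 \<le> tcount U (c' - 2)"
      using that by (auto simp: diagram_def)
    moreover from this have "(c' - 2) + (c - 1) + 4 \<le> 2 * n"
      using assms unfolding codes_iff_tcount[OF fin] by blast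
    ultimately show ?thesis by linarith
  qed
  have "i + c \<le> 2 * n" if D: "(i, c) \<in> diagram U" for i c
  proof -
    have ic: "1 \<le> i" "i \<le> c" using D by (auto simp: diagram_def)
    then have 1: "(1, c) \<in> diagram U" using down[OF D] by simp
    show ?thesis
    proof (cases "i = 1")
      case True
      then show ?thesis using one[OF 1] by simp
    next
      case False
      \<comment> \<open>With \<open>(1, c)\<close> this gives \<open>2 * c < 2 * n\<close>, and
        \<open>i \<le> c\<close> finishes.\<close>
      then have "(2, c) \<in> diagram U" using down[OF D] ic by simp
      then show ?thesis using two[OF 1] ic by fastforce
    qed
  qed
  then have "diagram U \<subseteq> boxes n" by (auto simp: boxes_def diagram_def)
  with two down_closed_diagram[OF fin] show ?thesis by (auto simp: abelian_diagrams_def)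
qed

text \<open>Both sequences obey the same backward recursion and vanish far out, so induction
  descends from a common bound.\<close>

lemma tcount_of_steps:
  assumes step: "\<And>t. N t = N (Suc t) + (if t \<in> U then 1 else 0)"
    and fin: "finite U" and zero: "\<And>t. m \<le> t \<Longrightarrow> N t = 0"
  shows "tcount U t = N t"
proof -
  obtain k where k: "U \<subseteq> {..<k}" using fin finite_nat_iff_bounded by blast
  let ?b = "max t (max m k)"
  have "t \<le> ?b" by simp
  then show ?thesis
  proof (induction t rule: inc_induct)
    case base
    have "{u \<in> U. ?b \<le> u} = {}" using k by auto
    then have "tcount U ?b = 0" by (simp only: tcount_def card.empty)
    then show ?case by (simp add: zero)
  next
    case (step s)
    then show ?case using tcount_Suc[OF fin, of s] assms(1)[of s] by simp
  qed
qed

text \<open>Down-closure makes every diagonal an initial segment of length \<open>N t\<close>. The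
  left neighbour of the last box on diagonal \<open>Suc t\<close> and the upper neighbour of the
  last box on diagonal \<open>t\<close> show that \<open>N\<close> drops by 0 or 1; the code
  collects the places of the drops.\<close>

lemma abelian_diagram_is_diagram:
  assumes "D \<in> abelian_diagrams n"
  shows "\<exists>U\<in>codes n. D = diagram U"
proof -
  have D: "D \<subseteq> boxes n" "down_closed D" "\<And>c c'. (1, c) \<in> D \<Longrightarrow> (2, c') \<in> D \<Longrightarrow> c + c' < 2 * n"
    using assms by (auto simp: abelian_diagrams_def)
  note down = down_closedD[OF D(2)]
  define N where "N t = card {i. (i, i + t) \<in> D}" for t
  have box: "1 \<le> i" "i \<le> c" "i + c \<le> 2 * n" if "(i, c) \<in> D" for i c
    using that D(1) by (auto simp: boxes_def)
  have fin: "finite {i. (i, i + t) \<in> D}" for t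
    by (rule finite_subset[of _ "{..2 * n}"]) (use box in fastforce)+
  have diag: "(i, i + t) \<in> D \<longleftrightarrow> 1 \<le> i \<and> i \<le> N t" for i t
  proof -
    have seg: "\<exists>k. {i. (i, i + t) \<in> D} = {1..k}"
    proof (cases "{i. (i, i + t) \<in> D} = {}")
      case True
      then show ?thesis by (intro exI[of _ 0]) simp
    next
      case False
      let ?k = "Max {i. (i, i + t) \<in> D}"
      have "?k \<in> {i. (i, i + t) \<in> D}" using fin False by (rule Max_in)
      then have k: "(?k, ?k + t) \<in> D" by simp
      have "{i. (i, i + t) \<in> D} = {1..?k}"
      proof (intro equalityI subsetI)
        fix i assume "i \<in> {i. (i, i + t) \<in> D}"
        then show "i \<in> {1..?k}" using Max_ge[OF fin] box by auto
      next
        fix i assume "i \<in> {1..?k}"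
        then show "i \<in> {i. (i, i + t) \<in> D}" using down[OF k, of i "i + t"] by simp
      qed
      then show ?thesis by blast
    qed
    then obtain k where k: "{i. (i, i + t) \<in> D} = {1..k}" by blast
    then have "N t = k" by (simp add: N_def)
    with k show ?thesis by auto
  qed
  have step1: "N (Suc t) \<le> N t" for t
  proof (cases "N (Suc t) = 0")
    case False
    then have "(N (Suc t), N (Suc t) + Suc t) \<in> D" by (simp add: diag del: add_Suc_right)
    from down[OF this, of "N (Suc t)" "N (Suc t) + t"] False show ?thesis by (simp add: diag)
  qed simp
  have step2: "N t \<le> Suc (N (Suc t))" for t
  proof (cases "N t \<le> 1")
    case False
    then have "(N t, N t + t) \<in> D" by (simp add: diag)
    then have "(N t - 1, (N t - 1) + Suc t) \<in> D"
      by (rule down) (use False in auto)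
    then have "N t - 1 \<le> N (Suc t)" by (simp only: diag)
    then show ?thesis by simp
  qed simp
  define U where "U = {t. N t \<noteq> N (Suc t)}"
  have zero: "N t = 0" if "2 * n \<le> t" for t
  proof (rule ccontr)
    assume "N t \<noteq> 0"
    then have "(1, 1 + t) \<in> D" by (simp add: diag del: One_nat_def)
    then show False using box(3)[of 1 "1 + t"] that by simp
  qed
  have "U \<subseteq> {..<2 * n}"
  proof
    fix t assume "t \<in> U"
    then show "t \<in> {..<2 * n}" using zero[of t] zero[of "Suc t"] by (cases "2 * n \<le> t") (auto simp: U_def)
  qed
  then have finU: "finite U" by (rule finite_subset) simp
  have tc: "tcount U t = N t" for t
  proof (rule tcount_of_steps[OF _ finU zero])
    show "N t = N (Suc t) + (if t \<in> U then 1 else 0)" for t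
      using step1[of t] step2[of t] by (simp add: U_def)
  qed
  have "D = diagram U"
  proof (intro set_eqI)
    fix x :: "nat \<times> nat"
    obtain i c where x: "x = (i, c)" by fastforce
    show "x \<in> D \<longleftrightarrow> x \<in> diagram U"
      using diag[of i "c - i"] box[of i c] by (auto simp: x diagram_def tc)
  qed
  moreover have "U \<in> codes n"
    unfolding codes_iff_tcount[OF finU] tc
  proof (intro conjI allI impI)
    fix t assume "1 \<le> N t"
    then have "(1, 1 + t) \<in> D" by (simp add: diag del: One_nat_def)
    then show "t + 2 \<le> 2 * n" using box(3)[of 1 "1 + t"] by simp
    fix s assume "2 \<le> N s"
    then have "(2, 2 + s) \<in> D" by (subst diag) simp
    then show "s + t + 4 \<le> 2 * n" using D(3)[OF \<open>(1, 1 + t) \<in> D\<close>] by fastforce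
  qed
  ultimately show ?thesis by blast
qed

section \<open>Ideals indexed by codes, and their coverings\<close>

definition ideal_of_code :: "nat \<Rightarrow> nat set \<Rightarrow> (nat \<Rightarrow> int) set" where
  "ideal_of_code n U = box_root n ` diagram U"

lemma Ab_B_eq_codes: "Ab_B n = ideal_of_code n ` codes n"
  unfolding Ab_B_eq ideal_of_code_def using diagram_code abelian_diagram_is_diagram by blast

lemma ideal_of_code_subset_iff:
  assumes "U \<in> codes n" "V \<in> codes n"
  shows "ideal_of_code n U \<subseteq> ideal_of_code n V \<longleftrightarrow> (\<forall>t. tcount U t \<le> tcount V t)"
proof -
  have "diagram U \<subseteq> boxes n" "diagram V \<subseteq> boxes n"
    using diagram_code assms by (auto simp: abelian_diagrams_def)
  then have "box_root n ` diagram U \<subseteq> box_root n ` diagram V \<longleftrightarrow> diagram U \<subseteq> diagram V"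
    using inj_on_image_mem_iff[OF inj_on_box_root[of n], of _ "diagram V"] by blast
  then show ?thesis by (simp add: ideal_of_code_def diagram_subset_iff)
qed

lemma inj_on_ideal_of_code: "inj_on (ideal_of_code n) (codes n)"
proof (rule inj_onI)
  fix U V assume "U \<in> codes n" "V \<in> codes n" "ideal_of_code n U = ideal_of_code n V"
  then show "U = V"
    using ideal_of_code_subset_iff[of U n V] ideal_of_code_subset_iff[of V n U]
    by (intro tcount_inject finite_code[of _ n] le_antisym) auto
qed

text \<open>
  Enlarging diagonal \<open>t\<close> by one box replaces the part \<open>t\<close> (which is empty if \<open>t = 0\<close>) by \<open>t + 1\<close>.
  If \<open>t = 0\<close>, the truncated \<open>t - 1 = 0\<close> in \<open>add_at\<close> removes nothing, as then \<open>0 \<notin> U\<close>.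
\<close>

definition addable :: "nat set \<Rightarrow> nat \<Rightarrow> bool" where
  "addable U t \<longleftrightarrow> t \<notin> U \<and> (t = 0 \<or> t - 1 \<in> U)"

definition add_at :: "nat set \<Rightarrow> nat \<Rightarrow> nat set" where
  "add_at U t = insert t (U - {t - 1})"

lemma tcount_add_at:
  assumes "finite U" "addable U t"
  shows "tcount (add_at U t) s = tcount U s + (if s = t then 1 else 0)"
proof -
  consider "t < s" | "s = t" | "s < t" by linarith
  then show ?thesis
  proof cases
    case 1
    then have "{u \<in> add_at U t. s \<le> u} = {u \<in> U. s \<le> u}" by (auto simp: add_at_def)
    with 1 show ?thesis by (simp add: tcount_def)
  next
    case 2
    then have "{u \<in> add_at U t. s \<le> u} = insert t {u \<in> U. s \<le> u}"
      using assms by (auto simp: add_at_def addable_def)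
    with 2 assms show ?thesis by (simp add: tcount_def addable_def)
  next
    case 3
    then have "{u \<in> add_at U t. s \<le> u} = insert t ({u \<in> U. s \<le> u} - {t - 1})"
      by (auto simp: add_at_def)
    moreover have "t - 1 \<in> {u \<in> U. s \<le> u}" "t \<notin> {u \<in> U. s \<le> u} - {t - 1}"
      using 3 assms by (auto simp: addable_def)
    moreover from this(1) have "card {u \<in> U. s \<le> u} = Suc (card ({u \<in> U. s \<le> u} - {t - 1}))"
      using assms(1) by (intro card.remove) auto
    ultimately show ?thesis using 3 assms(1) by (simp add: tcount_def del: card_Diff_insert)
  qed
qed

lemma ex_addable_below:
  assumes fin: "finite U" "finite V" and le: "\<And>t. tcount U t \<le> tcount V t" and ne: "U \<noteq> V"
  shows "\<exists>t. addable U t \<and> (\<forall>s. tcount (add_at U t) s \<le> tcount V s)"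
proof -
  \<comment> \<open>A diagonal whose first missing box has minimal coordinate sum.\<close>
  have "\<exists>t. tcount U t < tcount V t"
    using tcount_inject[OF fin] ne le by (meson le_neq_implies_less)
  then obtain t where t: "tcount U t < tcount V t"
    and min: "\<And>s. tcount U s < tcount V s \<Longrightarrow> 2 * tcount U t + t \<le> 2 * tcount U s + s"
    using ex_has_least_nat[of "\<lambda>t. tcount U t < tcount V t" _ "\<lambda>t. 2 * tcount U t + t"] by blast
  \<comment> \<open>Otherwise the box above the first missing one would be missing too, on diagonal
    \<open>Suc t\<close> and with smaller coordinate sum.\<close>
  have "t \<notin> U"
  proof
    assume "t \<in> U"
    then have "tcount U t = Suc (tcount U (Suc t))" using tcount_Suc[OF fin(1), of t] by simp
    moreover have "tcount V t \<le> Suc (tcount V (Suc t))" using tcount_Suc[OF fin(2), of t] by simp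
    ultimately show False using t min[of "Suc t"] by simp
  qed
  moreover have "t = 0 \<or> t - 1 \<in> U"
  proof (rule ccontr)
    assume "\<not> (t = 0 \<or> t - 1 \<in> U)"
    then obtain r where r: "t = Suc r" "r \<notin> U" by (cases t) auto
    then show False
      using t min[of r] tcount_Suc[OF fin(1), of r] tcount_Suc[OF fin(2), of r] by simp
  qed
  ultimately have "addable U t" by (simp add: addable_def)
  moreover have "tcount (add_at U t) s \<le> tcount V s" for s
    using t le[of s] by (auto simp: tcount_add_at[OF fin(1) \<open>addable U t\<close>])
  ultimately show ?thesis by blast
qed

text \<open>Below any strictly larger code lies a one-box extension of \<open>U\<close>, itself a
  code by \<open>codes_mono\<close>; a covering must equal it. Conversely, one extra box on one
  diagonal leaves no room for an intermediate code.\<close>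

lemma covers_in_Ab_B_iff:
  assumes U: "U \<in> codes n" and V: "V \<in> codes n"
  shows "covers_in (Ab_B n) (ideal_of_code n V) (ideal_of_code n U) \<longleftrightarrow>
    (\<exists>t. addable U t \<and> V = add_at U t)"
proof
  note fin = finite_code[OF U] finite_code[OF V]
  assume c: "covers_in (Ab_B n) (ideal_of_code n V) (ideal_of_code n U)"
  then have "ideal_of_code n U \<subset> ideal_of_code n V" by (simp add: covers_in_def)
  then have "\<And>t. tcount U t \<le> tcount V t" "U \<noteq> V"
    using ideal_of_code_subset_iff[OF U V] by auto
  from ex_addable_below[OF fin this] obtain t
    where t: "addable U t" and le: "\<And>s. tcount (add_at U t) s \<le> tcount V s" by blast
  let ?W = "add_at U t"
  have W: "?W \<in> codes n"
    using V _ le by (rule codes_mono) (simp add: add_at_def fin)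
  have "ideal_of_code n U \<subset> ideal_of_code n ?W"
    unfolding psubset_eq ideal_of_code_subset_iff[OF U W] less_le_not_le
    using ideal_of_code_subset_iff[OF W U]
    by (auto simp: tcount_add_at[OF fin(1) t] dest: spec[of _ t])
  moreover have "ideal_of_code n ?W \<subseteq> ideal_of_code n V"
    using le ideal_of_code_subset_iff[OF W V] by blast
  moreover have "ideal_of_code n ?W \<in> Ab_B n" using W by (simp add: Ab_B_eq_codes)
  ultimately have "ideal_of_code n ?W = ideal_of_code n V"
    using c unfolding covers_in_def by (metis order_le_less)
  then have "V = ?W" using inj_onD[OF inj_on_ideal_of_code _ W V] by simp
  with t show "\<exists>t. addable U t \<and> V = add_at U t" by blast
next
  assume "\<exists>t. addable U t \<and> V = add_at U t"
  then obtain t where t: "addable U t" and Vt: "V = add_at U t" by blast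
  have tc: "tcount V s = tcount U s + (if s = t then 1 else 0)" for s
    unfolding Vt by (rule tcount_add_at[OF finite_code[OF U] t])
  have "ideal_of_code n U \<subseteq> ideal_of_code n V" "\<not> ideal_of_code n V \<subseteq> ideal_of_code n U"
    by (auto simp: ideal_of_code_subset_iff U V tc intro: exI[of _ t])
  moreover have False
    if W: "W \<in> codes n" and lt: "ideal_of_code n U \<subset> ideal_of_code n W"
      "ideal_of_code n W \<subset> ideal_of_code n V" for W
  proof -
    have le: "tcount U s \<le> tcount W s" "tcount W s \<le> tcount V s" for s
      using lt W U V ideal_of_code_subset_iff by blast+
    show False
    proof (cases "tcount W t = tcount U t")
      case True
      have "tcount W s = tcount U s" for s
        using le[of s] True by (cases "s = t") (auto simp: tc)
      then have "ideal_of_code n W \<subseteq> ideal_of_code n U"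
        by (simp add: ideal_of_code_subset_iff W U)
      with lt show False by blast
    next
      case False
      have "tcount V s \<le> tcount W s" for s
        using le[of s] False by (cases "s = t") (auto simp: tc)
      then have "ideal_of_code n V \<subseteq> ideal_of_code n W"
        by (simp add: ideal_of_code_subset_iff W V)
      with lt show False by blast
    qed
  qed
  ultimately show "covers_in (Ab_B n) (ideal_of_code n V) (ideal_of_code n U)"
    unfolding covers_in_def Ab_B_eq_codes using U V by blast
qed

lemma inj_on_add_at:
  assumes "finite U"
  shows "inj_on (add_at U) {t. addable U t}"
proof (rule inj_onI)
  fix s t assume "s \<in> {t. addable U t}" "t \<in> {t. addable U t}" "add_at U s = add_at U t"
  then show "s = t"
    using tcount_add_at[OF assms, of s s] tcount_add_at[OF assms, of t s]
    by (simp split: if_splits)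
qed

lemma iota_ideal_of_code:
  assumes U: "U \<in> codes n"
  shows "iota (Ab_B n) (ideal_of_code n U) = card {t. addable U t \<and> add_at U t \<in> codes n}"
proof -
  have "{y \<in> Ab_B n. covers_in (Ab_B n) y (ideal_of_code n U)} =
      ideal_of_code n ` add_at U ` {t. addable U t \<and> add_at U t \<in> codes n}"
    using covers_in_Ab_B_iff[OF U] unfolding Ab_B_eq_codes[of n] by auto
  moreover have "inj_on (ideal_of_code n) (add_at U ` {t. addable U t \<and> add_at U t \<in> codes n})"
    by (rule inj_on_subset[OF inj_on_ideal_of_code]) auto
  moreover have "inj_on (add_at U) {t. addable U t \<and> add_at U t \<in> codes n}"
    by (rule inj_on_subset[OF inj_on_add_at[OF finite_code[OF U]]]) auto
  ultimately show ?thesis by (simp add: iota_def card_image)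
qed

definition remove_at :: "nat set \<Rightarrow> nat \<Rightarrow> nat set" where
  "remove_at V t = (V - {t}) \<union> (if t = 0 then {} else {t - 1})"

lemma add_at_remove_at:
  assumes "t \<in> V" "t = 0 \<or> t - 1 \<notin> V"
  shows "addable (remove_at V t) t" "add_at (remove_at V t) t = V"
  using assms by (auto simp: addable_def add_at_def remove_at_def)

lemma remove_at_add_at:
  assumes "addable U t"
  shows "remove_at (add_at U t) t = U" "t \<in> add_at U t" "t = 0 \<or> t - 1 \<notin> add_at U t"
  using assms by (auto simp: addable_def add_at_def remove_at_def)

text \<open>A box can be removed exactly at the first element of each run. The result is always a
  code, since codes are closed under shrinking, so there is no boundary correction.\<close>

lemma kappa_ideal_of_code:
  assumes V: "V \<in> codes n"
  shows "kappa (Ab_B n) (ideal_of_code n V) = runs V"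
proof -
  let ?T = "{t \<in> V. t = 0 \<or> t - 1 \<notin> V}"
  have tc: "tcount V s = tcount (remove_at V t) s + (if s = t then 1 else 0)"
    if "t \<in> ?T" for s t
  proof -
    have "finite (remove_at V t)" using finite_code[OF V] by (simp add: remove_at_def)
    then show ?thesis
      using tcount_add_at[of "remove_at V t" t s] add_at_remove_at[of t V] that by simp
  qed
  have codes: "remove_at V ` ?T \<subseteq> codes n"
  proof
    fix U assume "U \<in> remove_at V ` ?T"
    then obtain t where "t \<in> ?T" "U = remove_at V t" by blast
    then show "U \<in> codes n"
      using tc[of t] finite_code[OF V] by (intro codes_mono[OF V]) (auto simp: remove_at_def)
  qed
  have *: "(\<exists>t. addable U t \<and> V = add_at U t) \<longleftrightarrow> U \<in> remove_at V ` ?T" for U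
  proof
    assume "\<exists>t. addable U t \<and> V = add_at U t"
    then obtain t where "addable U t" "V = add_at U t" by blast
    with remove_at_add_at[of U t] have "t \<in> ?T" "U = remove_at V t" by simp_all
    then show "U \<in> remove_at V ` ?T" by blast
  next
    assume "U \<in> remove_at V ` ?T"
    then obtain t where "t \<in> ?T" "U = remove_at V t" by blast
    with add_at_remove_at[of t V] have "addable U t" "V = add_at U t" by simp_all
    then show "\<exists>t. addable U t \<and> V = add_at U t" by blast
  qed
  have "{y \<in> Ab_B n. covers_in (Ab_B n) (ideal_of_code n V) y} = ideal_of_code n ` remove_at V ` ?T"
    using covers_in_Ab_B_iff[OF _ V] codes unfolding Ab_B_eq_codes[of n] * by blast
  moreover have "inj_on (ideal_of_code n) (remove_at V ` ?T)"
    by (rule inj_on_subset[OF inj_on_ideal_of_code codes])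
  moreover have "inj_on (remove_at V) ?T"
  proof (rule inj_onI)
    fix s t assume st: "s \<in> ?T" "t \<in> ?T" and eq: "remove_at V s = remove_at V t"
    show "s = t"
      using tc[OF st(1), of s] tc[OF st(2), of s] unfolding eq by (simp split: if_splits)
  qed
  ultimately show ?thesis by (simp add: kappa_def card_image runs_def)
qed

section \<open>Covering polynomials as sums over codes\<close>

lemma upper_cov_poly_Ab_B: "upper_cov_poly (Ab_B n) = (\<Sum>U\<in>codes n. monom 1 (runs U))"
proof -
  have "upper_cov_poly (Ab_B n) = (\<Sum>x\<in>ideal_of_code n ` codes n. monom 1 (kappa (Ab_B n) x))"
    by (simp add: upper_cov_poly_def flip: Ab_B_eq_codes)
  then show ?thesis by (simp add: sum.reindex[OF inj_on_ideal_of_code] kappa_ideal_of_code)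
qed

lemma lower_cov_poly_Ab_B:
  "lower_cov_poly (Ab_B n) =
     (\<Sum>U\<in>codes n. monom 1 (card {t. addable U t \<and> add_at U t \<in> codes n}))"
proof -
  have "lower_cov_poly (Ab_B n) = (\<Sum>x\<in>ideal_of_code n ` codes n. monom 1 (iota (Ab_B n) x))"
    by (simp add: lower_cov_poly_def flip: Ab_B_eq_codes)
  then show ?thesis by (simp add: sum.reindex[OF inj_on_ideal_of_code] iota_ideal_of_code)
qed

section \<open>The covering polynomials\<close>

text \<open>If the largest element is \<open>2 * n - 2 - r\<close>, the pair bound on another
  element \<open>s\<close> reads \<open>s + 2 \<le> r\<close>. By truncation both
  \<open>r = 0\<close> and \<open>r = 1\<close> leave only the empty rest.\<close>

lemma codes_eq:
  "codes n = Pow {..<n - 1} \<union> (\<Union>r<n. insert (2 * n - 2 - r) ` Pow {..<r - 1})"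
proof (intro equalityI subsetI)
  fix U assume U: "U \<in> codes n"
  show "U \<in> Pow {..<n - 1} \<union> (\<Union>r<n. insert (2 * n - 2 - r) ` Pow {..<r - 1})"
  proof (cases "U \<subseteq> {..<n - 1}")
    case False
    let ?M = "Max U"
    have fin: "finite U" using U by (rule finite_code)
    obtain u where u: "u \<in> U" "n - 1 \<le> u" using False by (auto simp: subset_iff not_less)
    then have M: "?M \<in> U" using fin by (intro Max_in) auto
    have "n - 1 \<le> ?M" using u Max_ge[OF fin, of u] by simp
    moreover have "?M + 2 \<le> 2 * n" using U M by (auto simp: codes_def)
    moreover have "s + ?M + 4 \<le> 2 * n" if "s \<in> U - {?M}" for s
    proof -
      have "s < ?M" using that Max_ge[OF fin, of s] by (auto simp: order_le_less)
      then show ?thesis using U M that by (auto simp: codes_def)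
    qed
    moreover define r where "r = 2 * n - 2 - ?M"
    ultimately have r: "r < n" "2 * n - 2 - r = ?M" and "U - {?M} \<subseteq> {..<r - 1}"
      by fastforce+
    moreover have "U = insert ?M (U - {?M})" using M by blast
    ultimately have "U \<in> insert ?M ` Pow {..<r - 1}" by blast
    with r(1) show ?thesis unfolding r(2)[symmetric] by blast
  qed simp
next
  fix U assume "U \<in> Pow {..<n - 1} \<union> (\<Union>r<n. insert (2 * n - 2 - r) ` Pow {..<r - 1})"
  then show "U \<in> codes n"
  proof (elim UnE)
    assume "U \<in> Pow {..<n - 1}"
    then have "t + 2 \<le> n" if "t \<in> U" for t using that by fastforce
    then show ?thesis unfolding codes_def by fastforce
  next
    assume "U \<in> (\<Union>r<n. insert (2 * n - 2 - r) ` Pow {..<r - 1})"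
    then obtain r T where 2: "r < n" "T \<subseteq> {..<r - 1}" "U = insert (2 * n - 2 - r) T"
      by auto
    have "s + 2 \<le> r" if "s \<in> T" for s using 2(2) that by fastforce
    then have T: "s + 3 \<le> n" "s + (2 * n - 2 - r) + 4 \<le> 2 * n" "\<not> 2 * n - 2 - r < s" if "s \<in> T" for s
      using that[THEN \<open>\<And>s. s \<in> T \<Longrightarrow> s + 2 \<le> r\<close>] 2(1) by auto
    have TT: "s + t + 4 \<le> 2 * n" if "s \<in> T" "t \<in> T" for s t
      using T(1)[OF that(1)] T(1)[OF that(2)] by simp
    show ?thesis
      unfolding codes_def 2(3)
    proof (intro CollectI ballI conjI impI)
      fix t assume t: "t \<in> insert (2 * n - 2 - r) T"
      then show "t + 2 \<le> 2 * n" using T(1)[of t] 2(1) by auto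
      fix s assume "s \<in> insert (2 * n - 2 - r) T" "s < t"
      with t show "s + t + 4 \<le> 2 * n" using T(2)[of s] T(3)[of t] TT[of s t] by auto
    qed
  qed
qed

lemma sum_codes:
  "(\<Sum>U\<in>codes n. f U) = (\<Sum>U\<in>Pow {..<n - 1}. f U) +
     (\<Sum>r<n. \<Sum>T\<in>Pow {..<r - 1}. f (insert (2 * n - 2 - r) T))"
proof -
  let ?B = "\<lambda>r. insert (2 * n - 2 - r) ` Pow {..<r - 1}"
  \<comment> \<open>The top element is at least \<open>n - 1\<close>, beyond all possible remaining
    elements; injectivity and disjointness follow.\<close>
  have notin: "2 * n - 2 - r \<notin> T" if "T \<subseteq> {..<r' - 1}" "r < n" "r' < n" for r r' T
    using that by (auto simp: subset_iff)
  have inj: "inj_on (insert (2 * n - 2 - r)) (Pow {..<r - 1})" if "r < n" for r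
  proof (rule inj_onI)
    fix S T assume "S \<in> Pow {..<r - 1}" "T \<in> Pow {..<r - 1}"
      and eq: "insert (2 * n - 2 - r) S = insert (2 * n - 2 - r) T"
    then have "2 * n - 2 - r \<notin> S" "2 * n - 2 - r \<notin> T" using notin that by blast+
    with eq show "S = T" by (simp add: insert_ident)
  qed
  have disj: "?B r \<inter> ?B r' = {}" if "r < n" "r' < n" "r \<noteq> r'" for r r'
  proof (rule ccontr)
    assume "?B r \<inter> ?B r' \<noteq> {}"
    then obtain S T where S: "S \<subseteq> {..<r - 1}" "T \<subseteq> {..<r' - 1}"
      "insert (2 * n - 2 - r) S = insert (2 * n - 2 - r') T" by blast
    then have "2 * n - 2 - r = 2 * n - 2 - r' \<or> 2 * n - 2 - r \<in> T" by blast
    then have "2 * n - 2 - r = 2 * n - 2 - r'" using notin S that by blast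
    with that show False by simp
  qed
  have "Pow {..<n - 1} \<inter> (\<Union>r<n. ?B r) = {}" by fastforce
  then have "(\<Sum>U\<in>codes n. f U) = (\<Sum>U\<in>Pow {..<n - 1}. f U) + (\<Sum>U\<in>(\<Union>r<n. ?B r). f U)"
    unfolding codes_eq by (intro sum.union_disjoint) auto
  also have "(\<Sum>U\<in>(\<Union>r<n. ?B r). f U) = (\<Sum>r<n. \<Sum>U\<in>?B r. f U)"
    using disj by (intro sum.UNION_disjoint) auto
  also have "\<dots> = (\<Sum>r<n. \<Sum>T\<in>Pow {..<r - 1}. f (insert (2 * n - 2 - r) T))"
  proof (rule sum.cong[OF refl])
    fix r assume "r \<in> {..<n}"
    then show "(\<Sum>U\<in>?B r. f U) = (\<Sum>T\<in>Pow {..<r - 1}. f (insert (2 * n - 2 - r) T))"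
      by (subst sum.reindex[OF inj]) simp_all
  qed
  finally show ?thesis .
qed

text \<open>In the second family the top element is at least \<open>n - 1\<close> and the others at
  most \<open>n - 3\<close>, so it is a run of its own and contributes a factor
  \<open>q\<close>.\<close>

lemma upper_cov_poly_eq:
  assumes "2 \<le> n"
  shows "upper_cov_poly (Ab_B n) =
    run_poly (n - 1) + monom 1 (Suc 0) * (\<Sum>r<n. run_poly (r - 1))"
proof -
  have "runs (insert (2 * n - 2 - r) T) = Suc (runs T)" if "r < n" "T \<subseteq> {..<r - 1}" for r T
  proof (rule runs_insert_separated)
    show "finite T" using that(2) by (rule finite_subset) simp
    show "2 * n - 2 - r \<notin> T" "Suc (2 * n - 2 - r) \<notin> T" "0 < 2 * n - 2 - r" "2 * n - 2 - r - 1 \<notin> T"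
      using that assms by fastforce+
  qed
  then show ?thesis
    by (simp add: upper_cov_poly_Ab_B sum_codes run_poly_def sum_distrib_left mult_monom)
qed

text \<open>The window is \<open>{..<n}\<close> because \<open>n - 2\<close> may be raised to
  \<open>n - 1\<close>. That is always legal: the remaining elements are then at most
  \<open>n - 3\<close>.\<close>

lemma card_addable_small:
  assumes n: "2 \<le> n" and U: "U \<subseteq> {..<n - 1}"
  shows "card {t. addable U t \<and> add_at U t \<in> codes n} = runs ({..<n} - U)"
proof -
  have "addable U t \<and> add_at U t \<in> codes n \<longleftrightarrow>
      t \<in> {..<n} - U \<and> (t = 0 \<or> t - 1 \<notin> {..<n} - U)" for t
  proof
    assume "addable U t \<and> add_at U t \<in> codes n"
    then show "t \<in> {..<n} - U \<and> (t = 0 \<or> t - 1 \<notin> {..<n} - U)"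
      using U n by (fastforce simp: addable_def)
  next
    assume t: "t \<in> {..<n} - U \<and> (t = 0 \<or> t - 1 \<notin> {..<n} - U)"
    then have "t \<notin> U" "t < n" "t = 0 \<or> t - 1 \<in> U" by auto
    moreover from this have "add_at U t \<in> codes n"
      using U n by (fastforce simp: codes_def add_at_def)
    ultimately show "addable U t \<and> add_at U t \<in> codes n" by (simp add: addable_def)
  qed
  then show ?thesis by (simp add: runs_def)
qed

text \<open>Additions below the top must keep the rest inside \<open>{..<r - 1}\<close>. Raising the
  top lowers \<open>r\<close> by one, which needs \<open>r \<ge> 1\<close> and a rest avoiding its
  maximal possible element \<open>r - 2\<close>.\<close>

lemma card_addable_large:
  assumes n: "2 \<le> n" and r: "r < n" and T: "T \<subseteq> {..<r - 1}"
  shows "card {t. addable (insert (2 * n - 2 - r) T) t \<and> add_at (insert (2 * n - 2 - r) T) t \<in> codes n} =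
    runs ({..<r - 1} - T) + (if 1 \<le> r \<and> r - 2 \<notin> T then 1 else 0)"
proof -
  define M where "M = 2 * n - 2 - r"
  have M: "1 \<le> M" "r \<le> M" "M + r + 2 = 2 * n" using n r by (auto simp: M_def)
  have ltT: "s + 2 \<le> r" if "s \<in> T" for s using T that by fastforce
  let ?U = "insert M T"
  let ?S = "{t \<in> {..<r - 1} - T. t = 0 \<or> t - 1 \<notin> {..<r - 1} - T}"
  have top: "addable ?U (Suc M) \<and> add_at ?U (Suc M) \<in> codes n \<longleftrightarrow> 1 \<le> r \<and> r - 2 \<notin> T"
  proof -
    have "addable ?U (Suc M)" using ltT M by (fastforce simp: addable_def)
    moreover have "M \<notin> T" using ltT M by fastforce
    then have "add_at ?U (Suc M) = insert (Suc M) T" by (auto simp: add_at_def)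
    moreover have "insert (Suc M) T \<in> codes n \<longleftrightarrow> 1 \<le> r \<and> r - 2 \<notin> T"
    proof
      assume c: "insert (Suc M) T \<in> codes n"
      then have "Suc M + 2 \<le> 2 * n" by (auto simp: codes_def)
      moreover have "r - 2 \<notin> T"
      proof
        assume "r - 2 \<in> T"
        with ltT[of "r - 2"] M have "r - 2 < Suc M" "2 \<le> r" by auto
        with c \<open>r - 2 \<in> T\<close> have "r - 2 + Suc M + 4 \<le> 2 * n" by (auto simp: codes_def)
        with M \<open>2 \<le> r\<close> show False by simp
      qed
      ultimately show "1 \<le> r \<and> r - 2 \<notin> T" using M by simp
    next
      assume *: "1 \<le> r \<and> r - 2 \<notin> T"
      have "s + 3 \<le> r" if "s \<in> T" for s
      proof -
        have "s \<noteq> r - 2" using * that by blast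
        with ltT[OF that] show ?thesis by linarith
      qed
      with * M show "insert (Suc M) T \<in> codes n" by (fastforce simp: codes_def)
    qed
    ultimately show ?thesis by simp
  qed
  have low: "addable ?U t \<and> add_at ?U t \<in> codes n \<longleftrightarrow> t \<in> ?S" if "t \<noteq> Suc M" for t
  proof
    assume a: "addable ?U t \<and> add_at ?U t \<in> codes n"
    then have t: "t \<notin> T" "t = 0 \<or> t - 1 \<in> T"
      using that by (auto simp: addable_def)
    then have "t < M" using ltT M by fastforce
    moreover have "t \<in> add_at ?U t" by (simp add: add_at_def)
    moreover have "M \<in> add_at ?U t" using \<open>t < M\<close> by (auto simp: add_at_def)
    ultimately have "t + M + 4 \<le> 2 * n" using a by (auto simp: codes_def)
    with t M show "t \<in> ?S" by auto
  next
    assume "t \<in> ?S"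
    then have t: "t < r - 1" "t \<notin> T" "t = 0 \<or> t - 1 \<in> T" by auto
    then have "addable ?U t" using M by (auto simp: addable_def)
    moreover have "add_at ?U t = insert M (insert t (T - {t - 1}))"
      using t M by (auto simp: add_at_def)
    moreover have "insert t (T - {t - 1}) \<subseteq> {..<r - 1}" using T t by auto
    ultimately have "addable ?U t" "add_at ?U t \<in> insert M ` Pow {..<r - 1}" by blast+
    then show "addable ?U t \<and> add_at ?U t \<in> codes n"
      using r unfolding codes_eq M_def by blast
  qed
  have "{t. addable ?U t \<and> add_at ?U t \<in> codes n} =
      ?S \<union> (if 1 \<le> r \<and> r - 2 \<notin> T then {Suc M} else {})" (is "?L = ?R")
  proof (rule set_eqI)
    fix t
    show "t \<in> ?L \<longleftrightarrow> t \<in> ?R"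
    proof (cases "t = Suc M")
      case True
      have "Suc M \<in> ?R \<longleftrightarrow> 1 \<le> r \<and> r - 2 \<notin> T" using M by auto
      with top show ?thesis by (simp only: True mem_Collect_eq)
    next
      case False
      show ?thesis using low[OF False] False by simp
    qed
  qed
  moreover have "Suc M \<notin> ?S" using M by auto
  moreover have "finite ?S" by (rule finite_subset[of _ "{..<r - 1}"]) auto
  moreover have "card (S \<union> (if c then {x} else {})) = card S + (if c then 1 else 0)"
    if "finite S" "x \<notin> S" for S :: "nat set" and x c
    using that by simp
  ultimately show ?thesis unfolding M_def[symmetric] runs_def by (simp only:)
qed

text \<open>The cases \<open>r = 0\<close> and \<open>r = 1\<close> give the two monomials. For
  \<open>r = s + 2\<close> the rest is split by whether it contains \<open>s\<close>: if so, the top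
  is stuck; if not, the top adds a factor \<open>q\<close> and \<open>s\<close> lies in the
  complement.\<close>

lemma lower_cov_poly_eq:
  "lower_cov_poly (Ab_B (Suc (Suc p))) =
    run_poly_last (Suc p) + monom 1 0 + monom 1 (Suc 0) +
    (\<Sum>s<p. run_poly s + monom 1 (Suc 0) * run_poly_last s)"
proof -
  let ?n = "Suc (Suc p)"
  let ?f = "\<lambda>U. monom 1 (card {t. addable U t \<and> add_at U t \<in> codes ?n}) :: int poly"
  let ?g = "\<lambda>r T. monom 1 (runs ({..<r - 1} - T) + (if 1 \<le> r \<and> r - 2 \<notin> T then 1 else 0)) :: int poly"
  have "(\<Sum>U\<in>Pow {..<?n - 1}. ?f U) = (\<Sum>U\<in>Pow {..<Suc p}. monom 1 (runs ({..<?n} - U)))"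
    by (intro sum.cong) (simp_all add: card_addable_small)
  also have "\<dots> = run_poly_last (Suc p)" by (rule run_poly_last_compl)
  finally have small: "(\<Sum>U\<in>Pow {..<?n - 1}. ?f U) = run_poly_last (Suc p)" .
  have runs_empty: "runs {} = 0" by (simp add: runs_def)
  have step: "(\<Sum>T\<in>Pow {..<Suc (Suc s) - 1}. ?g (Suc (Suc s)) T) =
      run_poly s + monom 1 (Suc 0) * run_poly_last s" for s
  proof -
    have "(\<Sum>T\<in>Pow {..<s}. ?g (Suc (Suc s)) T) =
        (\<Sum>T\<in>Pow {..<s}. monom 1 (Suc 0) * monom 1 (runs ({..<Suc s} - T)))"
      by (intro sum.cong) (auto simp: mult_monom)
    also have "\<dots> = monom 1 (Suc 0) * run_poly_last s"
      unfolding run_poly_last_compl[symmetric] by (rule sum_distrib_left[symmetric])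
    finally have 1: "(\<Sum>T\<in>Pow {..<s}. ?g (Suc (Suc s)) T) = monom 1 (Suc 0) * run_poly_last s" .
    have "{..<Suc s} - insert s T = {..<s} - T" for T by auto
    then have "(\<Sum>T\<in>Pow {..<s}. ?g (Suc (Suc s)) (insert s T)) =
        (\<Sum>T\<in>Pow {..<s}. monom 1 (runs ({..<s} - T)))"
      by (intro sum.cong) auto
    also have "\<dots> = run_poly s" by (rule run_poly_compl)
    finally have 2: "(\<Sum>T\<in>Pow {..<s}. ?g (Suc (Suc s)) (insert s T)) = run_poly s" .
    have "(\<Sum>T\<in>Pow {..<Suc (Suc s) - 1}. ?g (Suc (Suc s)) T) =
        (\<Sum>T\<in>Pow {..<Suc s}. ?g (Suc (Suc s)) T)"
      by (rule arg_cong[of _ _ "\<lambda>m. \<Sum>T\<in>Pow {..<m}. ?g (Suc (Suc s)) T"]) simp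
    also have "\<dots> = (\<Sum>T\<in>Pow {..<s}. ?g (Suc (Suc s)) T) +
        (\<Sum>T\<in>Pow {..<s}. ?g (Suc (Suc s)) (insert s T))"
      by (rule sum_Pow_lessThan_Suc)
    finally show ?thesis unfolding 1 2 by (simp only: add.commute)
  qed
  have "(\<Sum>r<?n. \<Sum>T\<in>Pow {..<r - 1}. ?f (insert (2 * ?n - 2 - r) T)) =
      (\<Sum>r<?n. \<Sum>T\<in>Pow {..<r - 1}. ?g r T)"
  proof (intro sum.cong refl)
    fix r T assume "r \<in> {..<?n}" "T \<in> Pow {..<r - 1}"
    then have "2 \<le> ?n" "r < ?n" "T \<subseteq> {..<r - 1}" by auto
    from card_addable_large[OF this] show "?f (insert (2 * ?n - 2 - r) T) = ?g r T"
      by (simp only:)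
  qed
  also have "\<dots> = (\<Sum>T\<in>Pow {..<0 - 1}. ?g 0 T) + ((\<Sum>T\<in>Pow {..<Suc 0 - 1}. ?g (Suc 0) T) +
      (\<Sum>s<p. \<Sum>T\<in>Pow {..<Suc (Suc s) - 1}. ?g (Suc (Suc s)) T))"
    by (simp only: sum.lessThan_Suc_shift)
  also have "\<dots> = monom 1 0 + (monom 1 (Suc 0) + (\<Sum>s<p. run_poly s + monom 1 (Suc 0) * run_poly_last s))"
    unfolding step by (simp add: runs_empty)
  finally show ?thesis
    unfolding lower_cov_poly_Ab_B sum_codes small by (simp only: add.assoc)
qed

section \<open>Comparison of coefficients\<close>

lemma coeff_sum_monom: "coeff (\<Sum>k\<le>n. monom (f k) k) j = (if j \<le> n then f j else 0)"
  by (simp add: coeff_sum)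

lemma coeff_upper_cov_poly:
  assumes "2 \<le> n"
  shows "coeff (upper_cov_poly (Ab_B n)) k = binom (n + 1) (2 * int k)"
proof -
  \<comment> \<open>At \<open>r = 0\<close> the truncated \<open>r - 1\<close> is \<open>0\<close>;
    \<open>binom 1\<close> and \<open>binom 0\<close> agree at even lower indices.\<close>
  have c: "coeff (run_poly (r - 1)) j = binom r (2 * int j)" for r j
  proof (cases r)
    case 0
    then show ?thesis by (auto simp: coeff_run_poly binom_Suc binom_0) presburger
  qed (simp add: coeff_run_poly)
  have n: "Suc (n - 1) = n" using assms by simp
  have "coeff (upper_cov_poly (Ab_B n)) k =
      binom n (2 * int k) + (if k = 0 then 0 else (\<Sum>r<n. binom r (2 * int (k - 1))))"
    by (simp add: upper_cov_poly_eq[OF assms] coeff_monom_1_mult coeff_sum c[unfolded One_nat_def]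
        del: of_nat_diff)
  \<comment> \<open>The hockey stick supplies the second term of Pascal's rule for
    \<open>binom (n + 1)\<close>.\<close>
  also have "(if k = 0 then 0 else (\<Sum>r<n. binom r (2 * int (k - 1)))) = binom n (2 * int k - 1)"
    by (cases k) (auto simp: sum_binom binom_neg add.commute)
  finally show ?thesis by (simp add: binom_Suc)
qed

lemma coeff_lower_cov_poly:
  "coeff (lower_cov_poly (Ab_B (Suc (Suc p)))) k =
    binom (Suc p) (2 * int k + 1) + binom (Suc (Suc p)) (2 * int k - 1) + binom (Suc p) (2 * int k - 2)"
proof -
  have shift: "(\<Sum>s<p. binom (Suc s) j) = binom (Suc p) (j + 1) - (if j = -1 then 1 else 0) - binom 0 j" for j
    using sum_binom[of j "Suc p"] by (simp only: sum.lessThan_Suc_shift)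
  have "(if k = 0 then 0 else coeff (run_poly_last s) (k - 1)) = binom (Suc s) (2 * int k - 3)" for s
    by (cases k) (auto simp: coeff_run_poly binom_neg)
  then have "coeff (lower_cov_poly (Ab_B (Suc (Suc p)))) k =
      binom (Suc (Suc p)) (2 * int k - 1) + (if k = 0 then 1 else 0) + (if k = 1 then 1 else 0) +
      ((\<Sum>s<p. binom (Suc s) (2 * int k)) + (\<Sum>s<p. binom (Suc s) (2 * int k - 3)))"
    by (simp add: lower_cov_poly_eq coeff_monom_1_mult coeff_sum coeff_run_poly sum.distrib)
  also have "\<dots> = binom (Suc p) (2 * int k + 1) + binom (Suc (Suc p)) (2 * int k - 1) + binom (Suc p) (2 * int k - 2)"
    \<comment> \<open>The omitted summand \<open>binom 0 (2 * int k)\<close> cancels the monomial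
      \<open>1\<close>, and the hockey-stick correction at lower index \<open>-1\<close>, that is
      \<open>k = 1\<close>, cancels \<open>q\<close>.\<close>
    unfolding shift by (auto simp: binom_0; presburger)
  finally show ?thesis .
qed

lemma coeff_linear_mult:
  "coeff ([:-1, 1:] * q) k = (case k of 0 \<Rightarrow> 0 | Suc j \<Rightarrow> coeff q j) - coeff (q :: int poly) k"
  by (simp add: coeff_pCons split: nat.split)

text \<open>Each factor \<open>q - 1\<close> takes a difference in steps of 2 in the lower index;
  zero values at negative indices make the formula uniform in \<open>k\<close>.\<close>

lemma coeff_deviation:
  assumes "\<And>k. coeff q k = - binom p (2 * int k + 1)"
  shows "coeff ([:-1, 1:]\<^sup>2 * q) k =
    2 * binom p (2 * int k - 1) - binom p (2 * int k + 1) - binom p (2 * int k - 3)"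
proof -
  have 1: "coeff ([:-1, 1:] * q) k = binom p (2 * int k + 1) - binom p (2 * int k - 1)" for k
    unfolding coeff_linear_mult by (cases k) (simp_all add: assms binom_neg add.commute)
  have "coeff ([:-1, 1:]\<^sup>2 * q) k = coeff ([:-1, 1:] * ([:-1, 1:] * q)) k"
    by (simp only: power2_eq_square mult.assoc)
  also have "\<dots> = 2 * binom p (2 * int k - 1) - binom p (2 * int k + 1) - binom p (2 * int k - 3)"
    unfolding coeff_linear_mult[of "[:-1, 1:] * q"] 1 by (cases k) (simp_all add: binom_neg add.commute)
  finally show ?thesis .
qed

theorem theorem5p3:
  fixes n :: nat
  assumes "n \<ge> 2"
  shows "upper_cov_poly (Ab_B n) =
           (\<Sum>k\<le>n. monom (binom (n + 1) (2 * int k)) k) \<and>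
         lower_cov_poly (Ab_B n) =
           (\<Sum>k\<le>n. monom (binom (n - 1) (2 * int k + 1) + binom n (2 * int k - 1)
                            + binom (n - 1) (2 * int k - 2)) k) \<and>
         deviation_poly (Ab_B n) =
           - (\<Sum>k\<le>n. monom (binom (n - 2) (2 * int k + 1)) k)"
proof -
  obtain p where n: "n = Suc (Suc p)" using assms by (metis add_2_eq_Suc le_Suc_ex)
  have upper: "coeff (upper_cov_poly (Ab_B n)) k = binom (n + 1) (2 * int k)" for k
    using assms by (rule coeff_upper_cov_poly)
  have lower: "coeff (lower_cov_poly (Ab_B n)) k =
      binom (n - 1) (2 * int k + 1) + binom n (2 * int k - 1) + binom (n - 1) (2 * int k - 2)" for k
    by (simp add: n coeff_lower_cov_poly)
  define D where "D = - (\<Sum>k\<le>n. monom (binom (n - 2) (2 * int k + 1)) k)"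
  have "coeff D k = - binom p (2 * int k + 1)" for k
    \<comment> \<open>Beyond the summation range the binomial coefficient vanishes.\<close>
    by (simp add: D_def coeff_sum_monom n binom_eq_0)
  note coeff_D = coeff_deviation[OF this]
  have "upper_cov_poly (Ab_B n) - lower_cov_poly (Ab_B n) = [:-1, 1:]\<^sup>2 * D"
    \<comment> \<open>Pascal's rule brings all terms to upper index \<open>p\<close>, where the
      identity is linear.\<close>
    by (rule poly_eqI) (simp only: coeff_diff coeff_D upper lower, simp add: n binom_Suc algebra_simps)
  then have "deviation_poly (Ab_B n) = D" by (rule deviation_poly_eqI)
  moreover have "upper_cov_poly (Ab_B n) = (\<Sum>k\<le>n. monom (binom (n + 1) (2 * int k)) k)"
    by (rule poly_eqI) (simp add: coeff_sum_monom upper binom_eq_0)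
  moreover have "lower_cov_poly (Ab_B n) =
      (\<Sum>k\<le>n. monom (binom (n - 1) (2 * int k + 1) + binom n (2 * int k - 1)
                            + binom (n - 1) (2 * int k - 2)) k)"
    using assms by (intro poly_eqI) (auto simp: coeff_sum_monom lower binom_eq_0)
  ultimately show ?thesis unfolding D_def by blast
qed

end
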